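(* Let $M\rightarrow M'$ be a matroid perspective on a finite linearly ordered set $E$. Then, as polynomials in $x,u,y,v,z$, $$t(M,M';x+u,y+v,z)=\sum_{A\subseteq E}x^{\iota_{M'}(A)}u^{cr_{M'}(A)}y^{\epsilon_M(A)}v^{nl_M(A)}z^{rcd_{M,M'}(A)}.$$
   Context: A matroid perspective $M\rightarrow M'$ is a pair of matroids $M,M'$ on the same finite set $E$ such that every circuit of $M$ is a union of circuits of $M'$. For a matroid $N$ on $E$ with rank function $r_N$, $r(N)=r_N(E)$, and $A\subseteq E$: $cr_N(A)=r(N)-r_N(A)$, $nl_N(A)=|A|-r_N(A)$; $\epsilon_N(A)$ is the number of $e\in E\setminus A$ that are the smallest element of some circuit of $N$ contained in $A\cup\{e\}$; $\iota_N(A)$ is the number of $e\in A$ that are the smallest element of some cocircuit of $N$ contained in $(E\setminus A)\cup\{e\}$. $rcd_{M,M'}(A)=r(M)-r(M')-(r_M(A)-r_{M'}(A))$, and $t(M,M';x,y,z)=\sum_{A\subseteq E}(x-1)^{r(M')-r_{M'}(A)}(y-1)^{|A|-r_M(A)}z^{rcd_{M,M'}(A)}$. *)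

theory Defs
  imports Main
begin

locale matroid =
  fixes E :: "'e set" and indep :: "'e set \<Rightarrow> bool"
  assumes finite_ground: "finite E"
    and indep_subset_ground: "indep X \<Longrightarrow> X \<subseteq> E"
    and indep_empty: "indep {}"
    and indep_subset: "indep Y \<Longrightarrow> X \<subseteq> Y \<Longrightarrow> indep X"
    and indep_augment:
      "indep X \<Longrightarrow> indep Y \<Longrightarrow> card X < card Y \<Longrightarrow> \<exists>e\<in>Y - X. indep (insert e X)"

definition matroid_rank :: "('e set \<Rightarrow> bool) \<Rightarrow> 'e set \<Rightarrow> nat" where
  "matroid_rank indep A = Max {card X |X. X \<subseteq> A \<and> indep X}"

definition matroid_basis :: "('e set \<Rightarrow> bool) \<Rightarrow> 'e set \<Rightarrow> bool" where
  "matroid_basis indep B \<longleftrightarrow> indep B \<and> (\<forall>X. indep X \<longrightarrow> B \<subseteq> X \<longrightarrow> X = B)"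

definition matroid_circuit :: "'e set \<Rightarrow> ('e set \<Rightarrow> bool) \<Rightarrow> 'e set \<Rightarrow> bool" where
  "matroid_circuit E indep C \<longleftrightarrow> C \<subseteq> E \<and> \<not> indep C \<and> (\<forall>X. X \<subset> C \<longrightarrow> indep X)"

definition dual_indep :: "'e set \<Rightarrow> ('e set \<Rightarrow> bool) \<Rightarrow> 'e set \<Rightarrow> bool" where
  "dual_indep E indep X \<longleftrightarrow> X \<subseteq> E \<and> (\<exists>B. matroid_basis indep B \<and> B \<inter> X = {})"

definition matroid_cocircuit :: "'e set \<Rightarrow> ('e set \<Rightarrow> bool) \<Rightarrow> 'e set \<Rightarrow> bool" where
  "matroid_cocircuit E indep C \<longleftrightarrow> matroid_circuit E (dual_indep E indep) C"

definition matroid_perspective ::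
    "'e set \<Rightarrow> ('e set \<Rightarrow> bool) \<Rightarrow> ('e set \<Rightarrow> bool) \<Rightarrow> bool" where
  "matroid_perspective E M M' \<longleftrightarrow> matroid E M \<and> matroid E M' \<and>
     (\<forall>C. matroid_circuit E M C \<longrightarrow> (\<exists>\<D>. (\<forall>D\<in>\<D>. matroid_circuit E M' D) \<and> C = \<Union>\<D>))"

definition smallest_in :: "'e::linorder \<Rightarrow> 'e set \<Rightarrow> bool" where
  "smallest_in e C \<longleftrightarrow> e \<in> C \<and> (\<forall>f\<in>C. e \<le> f)"

text \<open>
  All exponents below are natural numbers. The subtractions never truncate: \<open>corank\<close> and
  \<open>nullity\<close> are nonnegative because the rank function is monotone and bounded by cardinality,
  and for a perspective \<open>r\<^sub>M(A) - r\<^sub>M\<^sub>'(A)\<close> is nonnegative and monotone in \<open>A\<close>.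
\<close>

definition corank :: "'e set \<Rightarrow> ('e set \<Rightarrow> bool) \<Rightarrow> 'e set \<Rightarrow> nat" where
  "corank E N A = matroid_rank N E - matroid_rank N A"

definition nullity :: "('e set \<Rightarrow> bool) \<Rightarrow> 'e set \<Rightarrow> nat" where
  "nullity N A = card A - matroid_rank N A"

definition rcd :: "'e set \<Rightarrow> ('e set \<Rightarrow> bool) \<Rightarrow> ('e set \<Rightarrow> bool) \<Rightarrow> 'e set \<Rightarrow> nat" where
  "rcd E M M' A =
     (matroid_rank M E - matroid_rank M' E) - (matroid_rank M A - matroid_rank M' A)"

definition ext_activity :: "'e::linorder set \<Rightarrow> ('e set \<Rightarrow> bool) \<Rightarrow> 'e set \<Rightarrow> nat" where
  "ext_activity E N A =
     card {e \<in> E - A. \<exists>C. matroid_circuit E N C \<and> C \<subseteq> A \<union> {e} \<and> smallest_in e C}"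

definition int_activity :: "'e::linorder set \<Rightarrow> ('e set \<Rightarrow> bool) \<Rightarrow> 'e set \<Rightarrow> nat" where
  "int_activity E N A =
     card {e \<in> A. \<exists>C. matroid_cocircuit E N C \<and> C \<subseteq> (E - A) \<union> {e} \<and> smallest_in e C}"

text \<open>
  The Tutte polynomial of a perspective, evaluated at elements of an arbitrary commutative ring.
  Taking the ring to be a polynomial ring and the arguments to be (sums of) indeterminates yields
  the polynomial itself, so an identity valid for all commutative rings is in particular an
  identity of polynomials.
\<close>

definition tutte_perspective ::
    "'e set \<Rightarrow> ('e set \<Rightarrow> bool) \<Rightarrow> ('e set \<Rightarrow> bool) \<Rightarrow> 'a \<Rightarrow> 'a \<Rightarrow> 'a \<Rightarrow> 'a::comm_ring_1" where
  "tutte_perspective E M M' x y z =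
     (\<Sum>A\<in>Pow E. (x - 1) ^ (matroid_rank M' E - matroid_rank M' A) *
                  (y - 1) ^ (card A - matroid_rank M A) *
                  z ^ rcd E M M' A)"

end

theory Submission
  imports Defs
begin

text \<open>
  Deleting and contracting the largest element \<open>e\<close>, which is active only when it is an isthmus of
  \<open>M'\<close> or a loop of \<open>M\<close>, gives a recursion for the right-hand side. An isthmus contributes the
  factor \<open>x + u\<close>, a loop the factor \<open>y + v\<close>, and in the remaining case the coefficients involve
  \<open>z\<close> only. Hence the right-hand side depends on \<open>x\<close>, \<open>u\<close>, \<open>y\<close>, \<open>v\<close> only through \<open>x + u\<close> and
  \<open>y + v\<close>, and the choice \<open>x = y = 1\<close> turns it into the defining sum of the Tutte polynomial.
  Activities enter through ranks: \<open>e \<notin> A\<close> is externally active iff it lies in the closure of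
  \<open>{f \<in> A. e < f}\<close>, and \<open>e \<in> A\<close> is internally active iff it lies outside the closure of
  \<open>{f \<in> E. f < e} \<union> {f \<in> A. e < f}\<close>.
\<close>

section \<open>The rank function and closure\<close>

context matroid
begin

abbreviation rk :: "'e set \<Rightarrow> nat" where
  "rk \<equiv> matroid_rank indep"

lemma finite_indep: "indep X \<Longrightarrow> finite X"
  using finite_ground indep_subset_ground finite_subset by blast

lemma finite_indep_cards: "finite {card X |X. X \<subseteq> A \<and> indep X}"
proof (rule finite_subset)
  show "{card X |X. X \<subseteq> A \<and> indep X} \<subseteq> {..card E}"
    using indep_subset_ground finite_ground by (auto intro: card_mono)
qed simp

lemma card_le_rank:
  assumes "X \<subseteq> A" "indep X"
  shows "card X \<le> rk A"
  unfolding matroid_rank_def by (rule Max_ge[OF finite_indep_cards]) (use assms in blast)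

lemma rank_witness: obtains X where "X \<subseteq> A" "indep X" "card X = rk A"
proof -
  have "rk A \<in> {card X |X. X \<subseteq> A \<and> indep X}"
    unfolding matroid_rank_def by (rule Max_in[OF finite_indep_cards]) (use indep_empty in auto)
  then show thesis using that by auto
qed

lemma rank_mono: "A \<subseteq> B \<Longrightarrow> rk A \<le> rk B"
  by (metis card_le_rank rank_witness subset_trans)

lemma rank_empty: "rk {} = 0"
  by (metis card.empty rank_witness subset_empty)

lemma rank_insert_le: "rk (insert e A) \<le> Suc (rk A)"
proof -
  obtain X where X: "X \<subseteq> insert e A" "indep X" "card X = rk (insert e A)"
    by (rule rank_witness)
  have "card (X - {e}) \<le> rk A"
    using X by (intro card_le_rank) (auto intro: indep_subset)
  moreover have "card X \<le> Suc (card (X - {e}))"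
    by (cases "e \<in> X") (simp_all add: card_Suc_Diff1 finite_indep X)
  ultimately show ?thesis using X by simp
qed

lemma rank_insert_cases: "rk (insert e A) = rk A \<or> rk (insert e A) = Suc (rk A)"
  using rank_insert_le[of e A] rank_mono[OF subset_insertI, of A e] by auto

lemma rank_insert_outside: "e \<notin> E \<Longrightarrow> rk (insert e A) = rk A"
proof -
  assume "e \<notin> E"
  obtain X where X: "X \<subseteq> insert e A" "indep X" "card X = rk (insert e A)"
    by (rule rank_witness)
  then have "X \<subseteq> A" using \<open>e \<notin> E\<close> indep_subset_ground by blast
  then show ?thesis
    using X card_le_rank[of X A] rank_mono[OF subset_insertI, of A e] by auto
qed

lemma indep_extend:
  assumes "indep X" "X \<subseteq> A"
  obtains Y where "X \<subseteq> Y" "Y \<subseteq> A" "indep Y" "card Y = rk A"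
proof -
  have "\<exists>Y. X \<subseteq> Y \<and> Y \<subseteq> A \<and> indep Y \<and> card Y = rk A"
    using assms
  proof (induction "rk A - card X" arbitrary: X)
    case 0
    then show ?case using card_le_rank[of X A] by auto
  next
    case (Suc n)
    obtain Z where Z: "Z \<subseteq> A" "indep Z" "card Z = rk A" by (rule rank_witness)
    have "card X < card Z" using Suc.hyps(2) Z(3) by linarith
    then obtain e where e: "e \<in> Z - X" "indep (insert e X)"
      using indep_augment[OF Suc.prems(1) Z(2)] by blast
    have "n = rk A - card (insert e X)"
      using Suc.hyps(2) e finite_indep[OF Suc.prems(1)] by simp
    from Suc.hyps(1)[OF this e(2)] show ?case using e Z Suc.prems by auto
  qed
  then show thesis using that by auto
qed

text \<open>Monotonicity of closure. If \<open>e\<close> raised the rank of \<open>B\<close>, a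
  maximum independent subset of \<open>A\<close>, extended inside \<open>insert e B\<close>, would
  pick up \<open>e\<close>, and \<open>e\<close> would already raise the rank of
  \<open>A\<close>.\<close>

lemma rank_insert_eq_mono:
  assumes "A \<subseteq> B" "rk (insert e A) = rk A"
  shows "rk (insert e B) = rk B"
proof (rule ccontr)
  assume "rk (insert e B) \<noteq> rk B"
  then have B: "rk (insert e B) = Suc (rk B)" using rank_insert_cases by blast
  obtain X where X: "X \<subseteq> A" "indep X" "card X = rk A" by (rule rank_witness)
  have "X \<subseteq> insert e B" using X(1) assms(1) by blast
  with X(2) obtain Y where Y: "X \<subseteq> Y" "Y \<subseteq> insert e B" "indep Y" "card Y = rk (insert e B)"
    by (rule indep_extend)
  have "e \<in> Y"
    using card_le_rank[of Y B] Y B by auto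
  have "e \<notin> A"
    using B assms(1) by (metis insert_absorb n_not_Suc_n subsetD)
  have "indep (insert e X)"
    using Y \<open>e \<in> Y\<close> by (auto intro: indep_subset)
  then have "card (insert e X) \<le> rk (insert e A)"
    using X by (intro card_le_rank) auto
  then show False
    using X \<open>e \<notin> A\<close> assms(2) by (auto simp: card_insert_if finite_indep split: if_splits)
qed

lemma rank_insert_Suc_antimono:
  assumes "A \<subseteq> B" "rk (insert e B) = Suc (rk B)"
  shows "rk (insert e A) = Suc (rk A)"
  using assms rank_insert_eq_mono[of A B e] rank_insert_cases[of e A] by auto

lemma rank_Un_absorb:
  assumes "finite Z" "\<And>f. f \<in> Z \<Longrightarrow> rk (insert f A) = rk A"
  shows "rk (A \<union> Z) = rk A"
  using assms
proof (induction Z)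
  case (insert f Z)
  have "rk (insert f (A \<union> Z)) = rk (A \<union> Z)"
    using insert.prems by - (rule rank_insert_eq_mono[of A], auto)
  then show ?case using insert by simp
qed simp

lemma rank_Un_le_card:
  assumes "finite A"
  shows "rk (A \<union> B) \<le> card A + rk B"
  using assms
proof (induction A)
  case (insert a A)
  then show ?case using rank_insert_le[of a "A \<union> B"] by simp
qed simp

lemma indep_iff_rank:
  assumes "X \<subseteq> E"
  shows "indep X \<longleftrightarrow> rk X = card X"
proof
  have fin: "finite X" using assms finite_ground by (rule finite_subset)
  {
    assume "indep X"
    then show "rk X = card X"
      using card_le_rank[of X X] rank_Un_le_card[OF fin, of "{}"] by (simp add: rank_empty)
  next
    assume eq: "rk X = card X"
    obtain Y where "Y \<subseteq> X" "indep Y" "card Y = rk X" by (rule rank_witness)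
    with eq show "indep X" using card_subset_eq[OF fin, of Y] by auto
  }
qed

section \<open>Circuits and cocircuits through an element, in terms of rank\<close>

text \<open>A circuit puts \<open>e\<close> in the closure of its other elements, hence of
  \<open>S\<close>. Conversely, adding \<open>e\<close> to a maximum independent subset of
  \<open>S\<close> gives a dependent set, and a minimal dependent subset of it must contain
  \<open>e\<close>.\<close>

lemma circuit_through_iff:
  assumes "e \<in> E" "e \<notin> S"
  shows "(\<exists>C. matroid_circuit E indep C \<and> C \<subseteq> insert e S \<and> e \<in> C) \<longleftrightarrow>
    rk (insert e S) = rk S"
proof
  assume "\<exists>C. matroid_circuit E indep C \<and> C \<subseteq> insert e S \<and> e \<in> C"
  then obtain C where C: "matroid_circuit E indep C" "C \<subseteq> insert e S" "e \<in> C" by blast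
  from C have CE: "C \<subseteq> E" "\<not> indep C" "indep (C - {e})"
    by (auto simp: matroid_circuit_def)
  have "rk C \<noteq> Suc (rk (C - {e}))"
    using CE indep_iff_rank[of C] indep_iff_rank[of "C - {e}"]
      card.remove[OF finite_subset[OF CE(1) finite_ground] C(3)] by fastforce
  then have "rk (insert e (C - {e})) = rk (C - {e})"
    using rank_insert_cases[of e "C - {e}"] C(3) by (auto simp: insert_absorb)
  then show "rk (insert e S) = rk S"
    using C by - (rule rank_insert_eq_mono[of "C - {e}"], auto)
next
  assume eq: "rk (insert e S) = rk S"
  obtain X where X: "X \<subseteq> S" "indep X" "card X = rk S" by (rule rank_witness)
  have "\<not> indep (insert e X)"
  proof
    assume "indep (insert e X)"
    then have "card (insert e X) \<le> rk (insert e S)"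
      using X by (intro card_le_rank) auto
    then show False using X eq assms by (auto simp: card_insert_if finite_indep split: if_splits)
  qed
  moreover have "finite X" using X(2) by (rule finite_indep)
  ultimately obtain C where C: "C \<subseteq> insert e X" "\<not> indep C"
      "\<And>D. D \<subseteq> insert e X \<Longrightarrow> \<not> indep D \<Longrightarrow> D \<subseteq> C \<Longrightarrow> C = D"
    using finite_has_minimal2[of "{C. C \<subseteq> insert e X \<and> \<not> indep C}" "insert e X"] by auto
  have "matroid_circuit E indep C"
    unfolding matroid_circuit_def
  proof (intro conjI allI impI)
    show "C \<subseteq> E" using C(1) assms(1) indep_subset_ground[OF X(2)] by blast
    show "indep D" if "D \<subset> C" for D using C(1) C(3)[of D] that by blast
  qed (fact C(2))
  moreover have "e \<in> C"
    using C(1,2) indep_subset[OF X(2), of C] by blast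
  ultimately show "\<exists>C. matroid_circuit E indep C \<and> C \<subseteq> insert e S \<and> e \<in> C"
    using C X by blast
qed

lemma basis_iff_rank: "matroid_basis indep B \<longleftrightarrow> indep B \<and> card B = rk E"
proof
  assume B: "matroid_basis indep B"
  then have "indep B" by (simp add: matroid_basis_def)
  then obtain Y where "B \<subseteq> Y" "indep Y" "card Y = rk E"
    using indep_extend indep_subset_ground by metis
  then show "indep B \<and> card B = rk E"
    using B by (auto simp: matroid_basis_def)
next
  assume B: "indep B \<and> card B = rk E"
  show "matroid_basis indep B"
    unfolding matroid_basis_def
    by (metis B card_le_rank card_mono card_subset_eq finite_indep indep_subset_ground le_antisym)
qed

lemma dual_indep_iff_rank: "dual_indep E indep X \<longleftrightarrow> X \<subseteq> E \<and> rk (E - X) = rk E"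
proof -
  have "(\<exists>B. matroid_basis indep B \<and> B \<inter> X = {}) \<longleftrightarrow> rk (E - X) = rk E"
  proof
    assume "\<exists>B. matroid_basis indep B \<and> B \<inter> X = {}"
    then obtain B where "indep B" "card B = rk E" "B \<subseteq> E - X"
      using basis_iff_rank indep_subset_ground by blast
    then show "rk (E - X) = rk E"
      by (metis Diff_subset card_le_rank le_antisym rank_mono)
  next
    assume eq: "rk (E - X) = rk E"
    obtain B where "B \<subseteq> E - X" "indep B" "card B = rk (E - X)" by (rule rank_witness)
    then show "\<exists>B. matroid_basis indep B \<and> B \<inter> X = {}"
      using eq basis_iff_rank by auto
  qed
  then show ?thesis by (simp add: dual_indep_def)
qed

text \<open>Argued through hyperplanes and ranks rather than by applying
  \<open>circuit_through_iff\<close> to the dual, so the matroid axioms need not be verified for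
  \<open>dual_indep\<close>.\<close>

lemma cocircuit_through_iff:
  assumes "e \<in> E" "S \<subseteq> E" "e \<notin> S"
  shows "(\<exists>C. matroid_cocircuit E indep C \<and> C \<subseteq> E - S \<and> e \<in> C) \<longleftrightarrow>
    rk (insert e S) = Suc (rk S)"
proof
  assume "\<exists>C. matroid_cocircuit E indep C \<and> C \<subseteq> E - S \<and> e \<in> C"
  then obtain C where C: "matroid_cocircuit E indep C" "C \<subseteq> E - S" "e \<in> C" by blast
  from C(1,3) have "C \<subseteq> E" "rk (E - C) \<noteq> rk E" "rk (E - (C - {e})) = rk E"
    by (auto simp: matroid_cocircuit_def matroid_circuit_def dual_indep_iff_rank)
  moreover have "E - (C - {e}) = insert e (E - C)" using assms by auto
  ultimately have "rk (insert e (E - C)) = Suc (rk (E - C))"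
    using rank_insert_cases[of e "E - C"] by auto
  then show "rk (insert e S) = Suc (rk S)"
    using C assms by - (rule rank_insert_Suc_antimono[of S "E - C"], auto)
next
  assume S: "rk (insert e S) = Suc (rk S)"
  define \<T> where "\<T> = {T. S \<subseteq> T \<and> T \<subseteq> E \<and> rk (insert e T) = Suc (rk T)}"
  have "finite \<T>" "S \<in> \<T>"
    using S assms finite_ground by (auto simp: \<T>_def)
  \<comment> \<open>A maximal \<open>T\<close> whose closure avoids \<open>e\<close> is a hyperplane, so its complement is a cocircuit.\<close>
  then obtain T where T: "T \<in> \<T>" and max: "\<And>T'. T' \<in> \<T> \<Longrightarrow> T \<subseteq> T' \<Longrightarrow> T = T'"
    using finite_has_maximal[of \<T>] by auto
  have T': "S \<subseteq> T" "T \<subseteq> E" "rk (insert e T) = Suc (rk T)"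
    using T by (auto simp: \<T>_def)
  have eT: "e \<notin> T"
    using T'(3) by (metis insert_absorb n_not_Suc_n)
  have step: "rk (insert e (insert f T)) = rk (insert f T)" if "f \<in> E - T" for f
  proof -
    have "insert f T \<notin> \<T>" using max[of "insert f T"] that by auto
    then show ?thesis
      using that T' rank_insert_cases[of e "insert f T"] by (auto simp: \<T>_def)
  qed
  \<comment> \<open>An exchange: by \<open>step\<close> the set \<open>insert e (insert f T)\<close>
    has the rank of \<open>insert f T\<close>, at most \<open>Suc (rk T)\<close>, which
    \<open>insert e T\<close> already attains. Hence \<open>insert e T\<close> spans
    \<open>E\<close>.\<close>
  have "rk (insert f (insert e T)) = rk (insert e T)" if "f \<in> E" for f
  proof (cases "f \<in> T")
    case False
    then show ?thesis
      using step[of f] that rank_insert_le[of f T] T'(3) rank_insert_cases[of f "insert e T"]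
      by (auto simp: insert_commute)
  qed (simp add: insert_absorb)
  then have "rk (insert e T \<union> E) = rk (insert e T)"
    by (rule rank_Un_absorb[OF finite_ground])
  moreover have "insert e T \<union> E = E" using T' assms by auto
  ultimately have top: "rk E = rk (insert e T)" by simp
  \<comment> \<open>A proper subset of the complement misses some \<open>f\<close> outside
    \<open>T\<close>, and \<open>insert f T\<close> spans because its closure contains
    \<open>e\<close>.\<close>
  have full: "rk (E - X) = rk E" if X: "X \<subset> E - T" for X
  proof -
    obtain f where f: "f \<in> E - T" "f \<notin> X" using X by blast
    have "rk E \<le> rk (insert f T)"
      using top step[OF f(1)] rank_mono[OF insert_mono[OF subset_insertI], of e T f] by simp
    also have "\<dots> \<le> rk (E - X)" using f X T' by (intro rank_mono) auto
    finally show ?thesis using rank_mono[of "E - X" E] by auto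
  qed
  have "E - (E - T) = T" using T' by auto
  then have "matroid_cocircuit E indep (E - T)"
    using full top T' by (auto simp: matroid_cocircuit_def matroid_circuit_def dual_indep_iff_rank)
  then show "\<exists>C. matroid_cocircuit E indep C \<and> C \<subseteq> E - S \<and> e \<in> C"
    using T' eT assms by blast
qed

end

section \<open>Activities in terms of rank\<close>

lemma ext_activity_rank:
  fixes E :: "'e::linorder set"
  assumes "matroid E N" "A \<subseteq> E"
  shows "ext_activity E N A = card {e \<in> E - A.
    matroid_rank N (insert e {f \<in> A. e < f}) = matroid_rank N {f \<in> A. e < f}}"
proof -
  interpret matroid E N by fact
  have "(\<exists>C. matroid_circuit E N C \<and> C \<subseteq> A \<union> {e} \<and> smallest_in e C) \<longleftrightarrow>
      rk (insert e {f \<in> A. e < f}) = rk {f \<in> A. e < f}" if "e \<in> E - A" for e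
  proof -
    have "C \<subseteq> A \<union> {e} \<and> smallest_in e C \<longleftrightarrow> C \<subseteq> insert e {f \<in> A. e < f} \<and> e \<in> C" for C
      using that by (fastforce simp: smallest_in_def subset_iff le_less)
    then show ?thesis using circuit_through_iff[of e "{f \<in> A. e < f}"] that by simp
  qed
  then show ?thesis
    unfolding ext_activity_def by (intro arg_cong[where f = card] Collect_cong) auto
qed

text \<open>Minimality of \<open>e\<close> in the cocircuit excludes the elements below
  \<open>e\<close>, containment excludes the other elements of \<open>A\<close>; together these are
  the set to which \<open>cocircuit_through_iff\<close> is applied.\<close>

lemma int_activity_rank:
  fixes E :: "'e::linorder set"
  assumes "matroid E N" "A \<subseteq> E"
  shows "int_activity E N A = card {e \<in> A.
    matroid_rank N (insert e ({f \<in> E. f < e} \<union> {f \<in> A. e < f})) =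
      Suc (matroid_rank N ({f \<in> E. f < e} \<union> {f \<in> A. e < f}))}"
proof -
  interpret matroid E N by fact
  have "(\<exists>C. matroid_cocircuit E N C \<and> C \<subseteq> (E - A) \<union> {e} \<and> smallest_in e C) \<longleftrightarrow>
      rk (insert e ({f \<in> E. f < e} \<union> {f \<in> A. e < f})) =
        Suc (rk ({f \<in> E. f < e} \<union> {f \<in> A. e < f}))" if "e \<in> A" for e
  proof -
    have "C \<subseteq> (E - A) \<union> {e} \<and> smallest_in e C \<longleftrightarrow>
        C \<subseteq> E - ({f \<in> E. f < e} \<union> {f \<in> A. e < f}) \<and> e \<in> C" for C
    proof
      assume "C \<subseteq> (E - A) \<union> {e} \<and> smallest_in e C"
      then show "C \<subseteq> E - ({f \<in> E. f < e} \<union> {f \<in> A. e < f}) \<and> e \<in> C"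
        using that assms(2) by (fastforce simp: smallest_in_def)
    next
      assume *: "C \<subseteq> E - ({f \<in> E. f < e} \<union> {f \<in> A. e < f}) \<and> e \<in> C"
      have "f \<in> E" "e \<le> f" "f \<in> A \<Longrightarrow> f = e" if "f \<in> C" for f
      proof -
        have f: "f \<in> E" "\<not> f < e" "f \<in> A \<Longrightarrow> \<not> e < f" using * that by auto
        then show "f \<in> E" "e \<le> f" "f \<in> A \<Longrightarrow> f = e" by auto
      qed
      with * show "C \<subseteq> (E - A) \<union> {e} \<and> smallest_in e C"
        unfolding smallest_in_def by blast
    qed
    then show ?thesis
      using cocircuit_through_iff[of e "{f \<in> E. f < e} \<union> {f \<in> A. e < f}"] that assms(2) by auto
  qed
  then show ?thesis
    unfolding int_activity_def by (intro arg_cong[where f = card] Collect_cong) auto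
qed

section \<open>Comparison of the two ranks of a perspective\<close>

locale perspective =
  fixes E :: "'e::linorder set" and M M' :: "'e set \<Rightarrow> bool"
  assumes perspective: "matroid_perspective E M M'"
begin

sublocale M: matroid E M
  using perspective by (simp add: matroid_perspective_def)

sublocale M': matroid E M'
  using perspective by (simp add: matroid_perspective_def)

abbreviation r :: "'e set \<Rightarrow> nat" where "r \<equiv> matroid_rank M"
abbreviation r' :: "'e set \<Rightarrow> nat" where "r' \<equiv> matroid_rank M'"

text \<open>A circuit of \<open>M\<close> through \<open>e\<close> is a union of circuits of
  \<open>M'\<close>, one of which contains \<open>e\<close>. The circuit condition of the
  perspective is used only here.\<close>

lemma rank_insert_eq_imp:
  assumes "r (insert e X) = r X"
  shows "r' (insert e X) = r' X"
proof (cases "e \<in> E \<and> e \<notin> X")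
  case True
  then obtain C where C: "matroid_circuit E M C" "C \<subseteq> insert e X" "e \<in> C"
    using assms M.circuit_through_iff by blast
  then obtain \<D> where "\<forall>D\<in>\<D>. matroid_circuit E M' D" "C = \<Union>\<D>"
    using perspective by (meson matroid_perspective_def)
  with C True show ?thesis
    using M'.circuit_through_iff[of e X] by blast
next
  case False
  then show ?thesis
    by (auto simp: insert_absorb M'.rank_insert_outside)
qed

lemma rank_insert_Suc_imp: "r' (insert e X) = Suc (r' X) \<Longrightarrow> r (insert e X) = Suc (r X)"
  using rank_insert_eq_imp[of e X] M.rank_insert_cases[of e X] by auto

text \<open>Monotonicity of \<open>r - r'\<close>, in additive form to avoid truncated subtraction:
  whenever a new element raises \<open>r'\<close>, it also raises \<open>r\<close>.\<close>

lemma rank_diff_mono: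
  assumes "finite Z"
  shows "r' (Z \<union> X) + r X \<le> r (Z \<union> X) + r' X"
  using assms
proof (induction Z)
  case (insert e Z)
  then show ?case
    using rank_insert_eq_imp[of e "Z \<union> X"] M.rank_insert_cases[of e "Z \<union> X"]
      M'.rank_insert_cases[of e "Z \<union> X"] by auto
qed simp

lemma rank_le: "finite X \<Longrightarrow> r' X \<le> r X"
  using rank_diff_mono[of X "{}"] by (simp add: M.rank_empty M'.rank_empty)

section \<open>Sums over minors\<close>

text \<open>For \<open>B\<close> disjoint from \<open>L\<close> and \<open>A \<subseteq> L\<close>,
  these are the internally active elements in a minor on \<open>L\<close>. Contracting
  \<open>B\<close> subtracts the constant \<open>r' B\<close> from all ranks, so adjoining
  \<open>B\<close> to every argument suffices and no minor has to be built as a matroid.\<close>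

definition rel_int :: "'e set \<Rightarrow> 'e set \<Rightarrow> 'e set \<Rightarrow> 'e set" where
  "rel_int L B A = {e \<in> A. r' (insert e ({f \<in> L. f < e} \<union> {f \<in> A. e < f} \<union> B)) =
     Suc (r' ({f \<in> L. f < e} \<union> {f \<in> A. e < f} \<union> B))}"

definition rel_ext :: "'e set \<Rightarrow> 'e set \<Rightarrow> 'e set \<Rightarrow> 'e set" where
  "rel_ext L B A = {e \<in> L - A. r (insert e ({f \<in> A. e < f} \<union> B)) = r ({f \<in> A. e < f} \<union> B)}"

text \<open>The terms are regrouped so that a single subtraction remains; the constants
  \<open>r B\<close> and \<open>r' B\<close> from the contraction cancel.\<close>

definition rel_rcd :: "'e set \<Rightarrow> 'e set \<Rightarrow> 'e set \<Rightarrow> nat" where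
  "rel_rcd L B A = (r (L \<union> B) + r' (A \<union> B)) - (r' (L \<union> B) + r (A \<union> B))"

text \<open>The five statistics of the minor obtained by restricting to \<open>L \<union> B\<close> and contracting \<open>B\<close>.\<close>
definition minor_term ::
    "'a::comm_ring_1 \<Rightarrow> 'a \<Rightarrow> 'a \<Rightarrow> 'a \<Rightarrow> 'a \<Rightarrow> 'e set \<Rightarrow> 'e set \<Rightarrow> 'e set \<Rightarrow> 'a" where
  "minor_term x u y v z L B A =
     x ^ card (rel_int L B A) * u ^ (r' (L \<union> B) - r' (A \<union> B)) *
     y ^ card (rel_ext L B A) * v ^ (card A + r B - r (A \<union> B)) * z ^ rel_rcd L B A"

definition minor_sum ::
    "'a::comm_ring_1 \<Rightarrow> 'a \<Rightarrow> 'a \<Rightarrow> 'a \<Rightarrow> 'a \<Rightarrow> 'e set \<Rightarrow> 'e set \<Rightarrow> 'a" where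
  "minor_sum x u y v z L B = (\<Sum>A\<in>Pow L. minor_term x u y v z L B A)"

text \<open>Contracting an element that is a loop or an isthmus of the minor in both matroids has the
  same effect as deleting it.\<close>
lemma minor_sum_insert_const:
  assumes "\<And>S. B \<subseteq> S \<Longrightarrow> S \<subseteq> L \<union> B \<Longrightarrow> r (insert e S) = r S + c"
    and "\<And>S. B \<subseteq> S \<Longrightarrow> S \<subseteq> L \<union> B \<Longrightarrow> r' (insert e S) = r' S + c'"
  shows "minor_sum x u y v z L (insert e B) = minor_sum x u y v z L B"
proof -
  have "minor_term x u y v z L (insert e B) A = minor_term x u y v z L B A" if A: "A \<subseteq> L" for A
  proof -
    \<comment> \<open>Every rank in the summand is taken at some \<open>S \<union> B\<close> with
      \<open>S \<subseteq> L\<close>, so the shifts \<open>c\<close> and \<open>c'\<close> cancel in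
      each comparison and each difference.\<close>
    have r: "r (insert e (S \<union> B)) = r (S \<union> B) + c" "r' (insert e (S \<union> B)) = r' (S \<union> B) + c'"
      if "S \<subseteq> L" for S
      using assms(1)[of "S \<union> B"] assms(2)[of "S \<union> B"] that by blast+
    have r_empty: "r (insert e B) = r B + c" using r[of "{}"] by simp
    have "rel_int L (insert e B) A = rel_int L B A"
    proof -
      have "r' (insert f ({g \<in> L. g < f} \<union> {g \<in> A. f < g} \<union> insert e B)) =
          r' (insert f ({g \<in> L. g < f} \<union> {g \<in> A. f < g} \<union> B)) + c'"
        "r' ({g \<in> L. g < f} \<union> {g \<in> A. f < g} \<union> insert e B) =
          r' ({g \<in> L. g < f} \<union> {g \<in> A. f < g} \<union> B) + c'" if "f \<in> A" for f
        using r(2)[of "insert f ({g \<in> L. g < f} \<union> {g \<in> A. f < g})"]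
          r(2)[of "{g \<in> L. g < f} \<union> {g \<in> A. f < g}"] A that
        by (auto simp: insert_commute)
      then show ?thesis unfolding rel_int_def by auto
    qed
    moreover have "rel_ext L (insert e B) A = rel_ext L B A"
    proof -
      have "r (insert f ({g \<in> A. f < g} \<union> insert e B)) =
          r (insert f ({g \<in> A. f < g} \<union> B)) + c"
        "r ({g \<in> A. f < g} \<union> insert e B) = r ({g \<in> A. f < g} \<union> B) + c" if "f \<in> L" for f
        using r(1)[of "insert f {g \<in> A. f < g}"] r(1)[of "{g \<in> A. f < g}"] A that
        by (auto simp: insert_commute)
      then show ?thesis unfolding rel_ext_def by auto
    qed
    ultimately show ?thesis
      by (simp add: minor_term_def rel_rcd_def r[OF A] r[OF order_refl] r_empty)
  qed
  then show ?thesis unfolding minor_sum_def by (intro sum.cong) auto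
qed

section \<open>Deletion and contraction of the largest element\<close>

text \<open>Sets avoiding \<open>e\<close> give the deletion, sets containing it the contraction.
  The exponents are 0 or 1: \<open>i\<close> and \<open>j\<close> detect an isthmus of the minor of
  \<open>M'\<close> and of \<open>M\<close>, \<open>l\<close> a loop of the minor of
  \<open>M\<close>. Since \<open>e\<close> is largest, it enters the activity test of a smaller
  element only if it lies in the summed set, and then acts like an element of
  \<open>B\<close>.\<close>

lemma minor_sum_insert_max:
  fixes L B :: "'e set"
  assumes fin: "finite L" and max: "\<And>f. f \<in> L \<Longrightarrow> f < e"
  defines "i \<equiv> r' (insert e (L \<union> B)) - r' (L \<union> B)"
    and "j \<equiv> r (insert e (L \<union> B)) - r (L \<union> B)"
    and "l \<equiv> Suc (r B) - r (insert e B)"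
  shows "minor_sum x u y v z (insert e L) B =
    u ^ i * y ^ l * z ^ (j - i) * minor_sum x u y v z L B +
    x ^ i * v ^ l * minor_sum x u y v z L (insert e B)"
proof -
  have eL: "e \<notin> L" using max by blast
  note nonmax = max[THEN less_not_sym]
  have i: "r' (insert e (L \<union> B)) = r' (L \<union> B) + i" "i \<le> 1"
    and j: "r (insert e (L \<union> B)) = r (L \<union> B) + j" and ij: "i \<le> j"
    and l: "r (insert e B) + l = Suc (r B)" "l \<le> 1"
    using M'.rank_insert_cases[of e "L \<union> B"] M.rank_insert_cases[of e "L \<union> B"]
      M.rank_insert_cases[of e B] rank_insert_eq_imp[of e "L \<union> B"]
    unfolding i_def j_def l_def by auto
  have out: "minor_term x u y v z (insert e L) B A =
      u ^ i * y ^ l * z ^ (j - i) * minor_term x u y v z L B A" if A: "A \<subseteq> L" for A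
  proof -
    have eA: "e \<notin> A" using A eL by auto
    have int: "rel_int (insert e L) B A = rel_int L B A"
    proof -
      have "{g \<in> insert e L. g < f} = {g \<in> L. g < f}" if "f \<in> A" for f
        using nonmax A that by auto
      then show ?thesis unfolding rel_int_def by auto
    qed
    have ext: "card (rel_ext (insert e L) B A) = l + card (rel_ext L B A)"
    proof -
      \<comment> \<open>Nothing in \<open>A\<close> lies above \<open>e\<close>, so its external
        activity depends on \<open>B\<close> alone.\<close>
      have none: "{f \<in> A. e < f} = {}" using nonmax A by auto
      have "rel_ext (insert e L) B A =
          (if l = 1 then insert e (rel_ext L B A) else rel_ext L B A)"
        using eA l M.rank_insert_cases[of e B] unfolding rel_ext_def by (auto simp: none)
      moreover have "finite (rel_ext L B A)" "e \<notin> rel_ext L B A"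
        using fin eL by (auto simp: rel_ext_def)
      ultimately show ?thesis using l by auto
    qed
    have r'le: "r' (A \<union> B) \<le> r' (L \<union> B)" using A by (intro M'.rank_mono) auto
    have cr: "r' (insert e L \<union> B) - r' (A \<union> B) = i + (r' (L \<union> B) - r' (A \<union> B))"
      using i r'le by simp
    \<comment> \<open>This keeps the subtraction in \<open>rel_rcd\<close> from truncating, so that
      \<open>j - i\<close> splits off.\<close>
    have "r' (L \<union> B) + r (A \<union> B) \<le> r (L \<union> B) + r' (A \<union> B)"
      using rank_diff_mono[of L "A \<union> B"] fin A by (simp add: Un_assoc[symmetric] sup.absorb1)
    then have rcd: "rel_rcd (insert e L) B A = (j - i) + rel_rcd L B A"
      using i j ij by (simp add: rel_rcd_def)
    show ?thesis
      unfolding minor_term_def int ext cr rcd by (simp add: power_add algebra_simps)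
  qed
  have inn: "minor_term x u y v z (insert e L) B (insert e A) =
      x ^ i * v ^ l * minor_term x u y v z L (insert e B) A" if A: "A \<subseteq> L" for A
  proof -
    have finA: "finite A" and eA: "e \<notin> A" using A fin eL finite_subset by auto
    have int: "card (rel_int (insert e L) B (insert e A)) = i + card (rel_int L (insert e B) A)"
    proof -
      \<comment> \<open>All of \<open>L\<close> lies below \<open>e\<close>, so its internal
        activity does not depend on \<open>A\<close>.\<close>
      have "{g \<in> insert e L. g < e} \<union> {g \<in> insert e A. e < g} \<union> B = L \<union> B"
        using nonmax A max by auto
      moreover have "{g \<in> insert e L. g < f} \<union> {g \<in> insert e A. f < g} \<union> B =
          {g \<in> L. g < f} \<union> {g \<in> A. f < g} \<union> insert e B" if "f \<in> A" for f
        using nonmax A max that by auto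
      ultimately have "rel_int (insert e L) B (insert e A) =
          (if i = 1 then insert e (rel_int L (insert e B) A) else rel_int L (insert e B) A)"
        using eA i unfolding rel_int_def by auto
      moreover have "finite (rel_int L (insert e B) A)" "e \<notin> rel_int L (insert e B) A"
        using finA eA by (auto simp: rel_int_def)
      ultimately show ?thesis using i by auto
    qed
    have ext: "rel_ext (insert e L) B (insert e A) = rel_ext L (insert e B) A"
    proof -
      have "{g \<in> insert e A. f < g} \<union> B = {g \<in> A. f < g} \<union> insert e B" if "f \<in> L" for f
        using max that by auto
      then show ?thesis using eL unfolding rel_ext_def by auto
    qed
    have "r (A \<union> insert e B) \<le> card A + r (insert e B)"
      by (rule M.rank_Un_le_card[OF finA])
    then have nl: "card (insert e A) + r B - r (insert e A \<union> B) =
        l + (card A + r (insert e B) - r (A \<union> insert e B))"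
      using l finA eA by simp
    have rcd: "rel_rcd (insert e L) B (insert e A) = rel_rcd L (insert e B) A"
      by (simp add: rel_rcd_def)
    show ?thesis
      unfolding minor_term_def int ext nl rcd by (simp add: power_add algebra_simps)
  qed
  have "inj_on (insert e) (Pow L)"
    using eL by (auto simp: inj_on_def)
  moreover have "Pow L \<inter> insert e ` Pow L = {}" using eL by auto
  ultimately show ?thesis
    using fin out inn
    by (simp add: minor_sum_def Pow_insert sum.union_disjoint sum.reindex sum_distrib_left)
qed

text \<open>\<open>B\<close> varies in the induction because contraction enlarges it. An isthmus of
  the minor of \<open>M'\<close> is one for \<open>M\<close>, and a loop for \<open>M\<close> is one
  for \<open>M'\<close>; in both cases deletion and contraction give equal sums, and their
  coefficients add.\<close>

lemma minor_sum_cong: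
  assumes "finite L" "x + u = x' + u'" "y + v = y' + v'"
  shows "minor_sum x u y v z L B = minor_sum x' u' y' v' z L B"
  using assms(1)
proof (induction L arbitrary: B rule: finite_linorder_max_induct)
  case empty
  show ?case by (simp add: minor_sum_def minor_term_def rel_int_def rel_ext_def)
next
  case (insert e L)
  have IH: "minor_sum x u y v z L B = minor_sum x' u' y' v' z L B"
    "minor_sum x u y v z L (insert e B) = minor_sum x' u' y' v' z L (insert e B)"
    using insert by auto
  have rec: "minor_sum x u y v z (insert e L) B =
      u ^ (r' (insert e (L \<union> B)) - r' (L \<union> B)) * y ^ (Suc (r B) - r (insert e B)) *
        z ^ ((r (insert e (L \<union> B)) - r (L \<union> B)) - (r' (insert e (L \<union> B)) - r' (L \<union> B))) *
        minor_sum x u y v z L B +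
      x ^ (r' (insert e (L \<union> B)) - r' (L \<union> B)) * v ^ (Suc (r B) - r (insert e B)) *
        minor_sum x u y v z L (insert e B)" for x u y v :: 'a
    using insert by (intro minor_sum_insert_max) auto
  consider (isthmus) "r' (insert e (L \<union> B)) = Suc (r' (L \<union> B))"
    | (loop) "r (insert e B) = r B"
    | (ordinary) "r' (insert e (L \<union> B)) = r' (L \<union> B)" "r (insert e B) = Suc (r B)"
    using M'.rank_insert_cases M.rank_insert_cases by blast
  then show ?case
  proof cases
    case isthmus
    then have ist: "r (insert e (L \<union> B)) = Suc (r (L \<union> B))" by (rule rank_insert_Suc_imp)
    have "minor_sum x u y v z L (insert e B) = minor_sum x u y v z L B" for x u y v :: 'a
      using M.rank_insert_Suc_antimono[OF _ ist] M'.rank_insert_Suc_antimono[OF _ isthmus]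
      by (intro minor_sum_insert_const[where c = 1 and c' = 1]) auto
    moreover have "r (insert e B) = Suc (r B)"
      using M.rank_insert_Suc_antimono[OF _ ist] by auto
    ultimately have "minor_sum x u y v z (insert e L) B = (x + u) * minor_sum x u y v z L B"
      for x u y v :: 'a
      by (simp add: rec isthmus ist algebra_simps)
    then show ?thesis using IH assms by simp
  next
    case loop
    then have loop': "r' (insert e B) = r' B" by (rule rank_insert_eq_imp)
    have "minor_sum x u y v z L (insert e B) = minor_sum x u y v z L B" for x u y v :: 'a
      using M.rank_insert_eq_mono[OF _ loop] M'.rank_insert_eq_mono[OF _ loop']
      by (intro minor_sum_insert_const[where c = 0 and c' = 0]) auto
    moreover have "r (insert e (L \<union> B)) = r (L \<union> B)" "r' (insert e (L \<union> B)) = r' (L \<union> B)"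
      using M.rank_insert_eq_mono[OF _ loop] M'.rank_insert_eq_mono[OF _ loop'] by auto
    ultimately have "minor_sum x u y v z (insert e L) B = (y + v) * minor_sum x u y v z L B"
      for x u y v :: 'a
      by (simp add: rec loop algebra_simps)
    then show ?thesis using IH assms by simp
  next
    case ordinary
    \<comment> \<open>The exponents of \<open>x\<close>, \<open>u\<close>, \<open>y\<close>,
      \<open>v\<close> all vanish, leaving the coefficients 1 and a power of
      \<open>z\<close>.\<close>
    then show ?thesis by (simp add: rec IH)
  qed
qed

section \<open>Back to the original perspective\<close>

lemma minor_sum_ground:
  "minor_sum x u y v z E {} =
    (\<Sum>A\<in>Pow E. x ^ int_activity E M' A * u ^ corank E M' A *
                 y ^ ext_activity E M A * v ^ nullity M A * z ^ rcd E M M' A)"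
  unfolding minor_sum_def
proof (rule sum.cong[OF refl])
  fix A assume "A \<in> Pow E"
  then have A: "A \<subseteq> E" "finite A" using M.finite_ground finite_subset by auto
  \<comment> \<open>The nested subtractions of \<open>rcd\<close> agree with the regrouped one
    because \<open>r'\<close> is at most \<open>r\<close> on both \<open>A\<close> and
    \<open>E\<close>.\<close>
  have "rel_rcd E {} A = rcd E M M' A"
    using rank_le[OF A(2)] rank_le[OF M.finite_ground] by (simp add: rel_rcd_def rcd_def)
  then show "minor_term x u y v z E {} A =
      x ^ int_activity E M' A * u ^ corank E M' A *
      y ^ ext_activity E M A * v ^ nullity M A * z ^ rcd E M M' A"
    by (simp add: minor_term_def rel_int_def rel_ext_def corank_def nullity_def M.rank_empty
        int_activity_rank[OF M'.matroid_axioms A(1)] ext_activity_rank[OF M.matroid_axioms A(1)])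
qed

end

theorem theorem4:
  fixes E :: "'e::linorder set"
    and M M' :: "'e set \<Rightarrow> bool"
    and x u y v z :: "'a::comm_ring_1"
  assumes "matroid_perspective E M M'"
  shows "tutte_perspective E M M' (x + u) (y + v) z =
    (\<Sum>A\<in>Pow E. x ^ int_activity E M' A * u ^ corank E M' A *
                 y ^ ext_activity E M A * v ^ nullity M A * z ^ rcd E M M' A)"
proof -
  interpret perspective E M M' by unfold_locales fact
  \<comment> \<open>The two arguments 1 erase the activities; \<open>x + u - 1\<close> and
    \<open>y + v - 1\<close> are the bases of the corank and nullity powers in the Tutte
    sum.\<close>
  have "tutte_perspective E M M' (x + u) (y + v) z =
      minor_sum 1 (x + u - 1) 1 (y + v - 1) z E {}"
    by (simp add: tutte_perspective_def minor_sum_ground corank_def nullity_def)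
  also have "\<dots> = minor_sum x u y v z E {}"
    by (rule minor_sum_cong) (simp_all add: M.finite_ground)
  finally show ?thesis by (simp add: minor_sum_ground)
qed

end
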